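(* Let $k\ge1$ and $T=\sum_{i=1}^kC_iZ_i$ with each $C_i$, $Z_i$ a compact operator on $\mathcal H$. Then $$s(T)\le\sum_{i=1}^kD_{2k}\bigl(s(C_i)\,s(Z_i)\bigr).$$ In particular, if $T=CZ-ZC$ with $C,Z$ both compact, then $s(T)\le2D_4\bigl(s(C)\,s(Z)\bigr)$.
   Context: $\mathcal H$ is an infinite dimensional separable complex Hilbert space. For a compact operator $T$ and $n\in\mathbb N=\{1,2,\dots\}$, $s_n(T)=\inf\{\|T-F\|:\operatorname{rank}F<n\}$ and $s(T)=(s_n(T))_{n\ge1}$ is the singular number sequence. For $m\in\mathbb N$ the $m$-ampliation of a sequence $(a_n)_{n\ge1}$ is $D_m((a_n))=(a_{\lceil n/m\rceil})_{n\ge1}$. Sums, products and inequalities of sequences are pointwise. *)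

theory Defs
  imports "HOL-Analysis.Analysis" "HOL-Library.Extended_Nat"
begin

class scaleC =
  fixes scaleC :: "complex \<Rightarrow> 'a \<Rightarrow> 'a"  (infixr "*\<^sub>C" 75)

text \<open>The inner product is conjugate-linear in the first argument and linear in the second.\<close>

class complex_hilbert_space = banach + scaleC +
  fixes cinner :: "'a \<Rightarrow> 'a \<Rightarrow> complex"
  assumes scaleC_add_right: "c *\<^sub>C (x + y) = c *\<^sub>C x + c *\<^sub>C y"
    and scaleC_add_left: "(c + d) *\<^sub>C x = c *\<^sub>C x + d *\<^sub>C x"
    and scaleC_scaleC: "c *\<^sub>C d *\<^sub>C x = (c * d) *\<^sub>C x"
    and scaleC_one: "1 *\<^sub>C x = x"
    and scaleR_scaleC: "r *\<^sub>R x = complex_of_real r *\<^sub>C x"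
    and cinner_commute: "cinner x y = cnj (cinner y x)"
    and cinner_add_right: "cinner x (y + z) = cinner x y + cinner x z"
    and cinner_scaleC_right: "cinner x (c *\<^sub>C y) = c * cinner x y"
    and cinner_self: "cinner x x = complex_of_real ((norm x)\<^sup>2)"

global_interpretation complex_vector:
  vector_space "scaleC :: complex \<Rightarrow> 'a \<Rightarrow> 'a::complex_hilbert_space"
  by unfold_locales
    (simp_all add: scaleC_add_right scaleC_add_left scaleC_scaleC scaleC_one)

definition finite_cdim :: "'a::complex_hilbert_space set \<Rightarrow> bool"
  where "finite_cdim S \<longleftrightarrow> (\<exists>B. finite B \<and> S \<subseteq> complex_vector.span B)"

definition bounded_clinear :: "('a::complex_hilbert_space \<Rightarrow> 'a) \<Rightarrow> bool"
  where "bounded_clinear T \<longleftrightarrow> bounded_linear T \<and> (\<forall>c x. T (c *\<^sub>C x) = c *\<^sub>C T x)"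

definition compact_operator :: "('a::complex_hilbert_space \<Rightarrow> 'a) \<Rightarrow> bool"
  where "compact_operator T \<longleftrightarrow> bounded_clinear T \<and> compact (closure (T ` cball 0 1))"

text \<open>The case distinction is needed because the library's \<open>dim\<close> is \<open>0\<close> on
  infinite-dimensional sets.\<close>

definition crank :: "('a::complex_hilbert_space \<Rightarrow> 'a) \<Rightarrow> enat"
  where "crank F =
    (if finite_cdim (range F) then enat (complex_vector.dim (range F)) else \<infinity>)"

text \<open>Sequences are indexed by \<open>n \<ge> 1\<close>; their value at \<open>0\<close> carries no meaning
  (for \<open>singular_number\<close> it is the infimum of the empty set).\<close>

definition singular_number :: "('a::complex_hilbert_space \<Rightarrow> 'a) \<Rightarrow> nat \<Rightarrow> real"
  where "singular_number T n =
    Inf {onorm (\<lambda>x. T x - F x) | F. bounded_clinear F \<and> crank F < enat n}"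

definition ampliation :: "nat \<Rightarrow> (nat \<Rightarrow> real) \<Rightarrow> nat \<Rightarrow> real"
  where "ampliation m a n = a (nat \<lceil>real n / real m\<rceil>)"

end

theory Submission
  imports Defs
begin

text \<open>
  The heart of the matter is the identity
  \[ C Z - (C - F)(Z - G) = F Z + (C - F) G. \]
  If \<open>F\<close> and \<open>G\<close> have rank less than \<open>j\<close>, each summand on the right factors through
  an operator of rank at most \<open>j - 1\<close>, so the product \<open>(C - F)(Z - G)\<close>, of norm at most
  \<open>\<parallel>C - F\<parallel> \<parallel>Z - G\<parallel>\<close>, differs from \<open>C Z\<close> by an operator of rank at most \<open>2 (j - 1)\<close>.
  Adding \<open>k\<close> such products gives a competitor of rank at most \<open>2 k (j - 1)\<close>
  for \<open>\<Sum>i. C\<^sub>i Z\<^sub>i\<close>; the index \<open>j = \<lceil>n / 2 k\<rceil>\<close> of the ampliation is exactly the largest one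
  for which this is still less than \<open>n\<close>.  Letting \<open>F\<^sub>i\<close> and \<open>G\<^sub>i\<close> run through approximants whose
  distances tend to \<open>s\<^sub>j(C\<^sub>i)\<close> and \<open>s\<^sub>j(Z\<^sub>i)\<close> yields the inequality.

  Ranks are handled through spanning sets: an operator has rank less than \<open>n\<close> iff fewer than \<open>n\<close>
  vectors span a space containing its range.  In this form a bound for sums and compositions is a
  matter of taking unions and images of spanning sets.

  The commutator is the case \<open>k = 2\<close> with \<open>C Z + (- Z) C\<close>, since \<open>s(- Z) = s(Z)\<close>.
\<close>

section \<open>Bounded complex-linear operators\<close>

lemma bounded_clinear_bounded_linear: "bounded_clinear T \<Longrightarrow> bounded_linear T"
  by (simp add: bounded_clinear_def)

lemma bounded_clinear_zero: "bounded_clinear (\<lambda>x. 0)"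
  by (simp add: bounded_clinear_def)

lemma bounded_clinear_add:
  "bounded_clinear S \<Longrightarrow> bounded_clinear T \<Longrightarrow> bounded_clinear (\<lambda>x. S x + T x)"
  by (simp add: bounded_clinear_def bounded_linear_add complex_vector.scale_right_distrib)

lemma bounded_clinear_diff:
  "bounded_clinear S \<Longrightarrow> bounded_clinear T \<Longrightarrow> bounded_clinear (\<lambda>x. S x - T x)"
  by (simp add: bounded_clinear_def bounded_linear_sub complex_vector.scale_right_diff_distrib)

lemma bounded_clinear_uminus: "bounded_clinear T \<Longrightarrow> bounded_clinear (\<lambda>x. - T x)"
  using bounded_clinear_diff[OF bounded_clinear_zero] by simp

lemma bounded_clinear_compose:
  "bounded_clinear S \<Longrightarrow> bounded_clinear T \<Longrightarrow> bounded_clinear (\<lambda>x. S (T x))"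
  by (simp add: bounded_clinear_def bounded_linear_compose)

lemma bounded_clinear_sum:
  "(\<And>i. i \<in> I \<Longrightarrow> bounded_clinear (T i)) \<Longrightarrow> bounded_clinear (\<lambda>x. \<Sum>i\<in>I. T i x)"
  by (simp add: bounded_clinear_def bounded_linear_sum complex_vector.scale_sum_right)

lemma bounded_clinear_span_image:
  assumes "bounded_clinear T"
  shows "complex_vector.span (T ` B) = T ` complex_vector.span B"
proof -
  interpret T: module_hom scaleC scaleC T
    using assms
    by unfold_locales
      (simp_all add: bounded_clinear_def linear_simps complex_vector.scale_right_distrib
        complex_vector.scale_left_distrib)
  show ?thesis by (rule T.span_image)
qed

section \<open>Rank\<close>

lemma crank_less_iff:
  fixes F :: "'a::complex_hilbert_space \<Rightarrow> 'a"
  shows "crank F < enat n \<longleftrightarrow>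
    (\<exists>B. finite B \<and> card B < n \<and> range F \<subseteq> complex_vector.span B)"
proof
  assume "crank F < enat n"
  then have "finite_cdim (range F)" and dim: "complex_vector.dim (range F) < n"
    by (auto simp: crank_def split: if_splits)
  then obtain A where A: "finite A" "range F \<subseteq> complex_vector.span A"
    by (auto simp: finite_cdim_def)
  obtain B where B: "B \<subseteq> range F" "complex_vector.independent B"
      "range F \<subseteq> complex_vector.span B" "card B = complex_vector.dim (range F)"
    by (rule complex_vector.basis_exists)
  \<comment> \<open>A cardinality below \<open>n\<close> says something only once the basis is known to be finite.\<close>
  have "finite B"
    using complex_vector.independent_span_bound[of A B] A B by auto
  then show "\<exists>B. finite B \<and> card B < n \<and> range F \<subseteq> complex_vector.span B"
    using B dim by auto
next
  assume "\<exists>B. finite B \<and> card B < n \<and> range F \<subseteq> complex_vector.span B"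
  then obtain B where B: "finite B" "card B < n" "range F \<subseteq> complex_vector.span B"
    by blast
  then have "complex_vector.dim (range F) \<le> card B"
    by (intro complex_vector.dim_le_card)
  then show "crank F < enat n"
    using B by (auto simp: crank_def finite_cdim_def)
qed

text \<open>The correction term \<open>F Z + (C - F) G\<close>, written with \<open>R\<close> for \<open>C - F\<close>: the range of
  \<open>F Z\<close> lies in that of \<open>F\<close>, and \<open>R\<close> carries a spanning set for \<open>G\<close> to one for \<open>R G\<close>.\<close>

lemma correction_spanning_set:
  assumes F: "crank F < enat j" and G: "crank G < enat j" and R: "bounded_clinear R"
  shows "\<exists>B. finite B \<and> card B \<le> 2 * (j - 1) \<and>
    range (\<lambda>x. F (Z x) + R (G x)) \<subseteq> complex_vector.span B"
proof -
  obtain A where A: "finite A" "card A < j" "range F \<subseteq> complex_vector.span A"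
    using F by (auto simp: crank_less_iff)
  obtain B where B: "finite B" "card B < j" "range G \<subseteq> complex_vector.span B"
    using G by (auto simp: crank_less_iff)
  have "F (Z x) + R (G x) \<in> complex_vector.span (A \<union> R ` B)" for x
  proof (rule complex_vector.span_add)
    show "F (Z x) \<in> complex_vector.span (A \<union> R ` B)"
      using A(3) complex_vector.span_mono[of A "A \<union> R ` B"] by blast
    have "R (G x) \<in> complex_vector.span (R ` B)"
      using B(3) by (auto simp: bounded_clinear_span_image[OF R])
    then show "R (G x) \<in> complex_vector.span (A \<union> R ` B)"
      using complex_vector.span_mono[of "R ` B" "A \<union> R ` B"] by blast
  qed
  moreover have "card (A \<union> R ` B) \<le> 2 * (j - 1)"
    using card_Un_le[of A "R ` B"] card_image_le[OF B(1), of R] A(2) B(2) by linarith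
  ultimately show ?thesis
    using A(1) B(1) by (intro exI[of _ "A \<union> R ` B"]) auto
qed

lemma sum_spanning_set:
  assumes I: "finite I"
    and span: "\<And>i. i \<in> I \<Longrightarrow> \<exists>B. finite B \<and> card B \<le> m \<and> range (F i) \<subseteq> complex_vector.span B"
  shows "\<exists>B. finite B \<and> card B \<le> card I * m \<and>
    range (\<lambda>x. \<Sum>i\<in>I. F i x) \<subseteq> complex_vector.span B"
proof -
  obtain B where B: "\<And>i. i \<in> I \<Longrightarrow> finite (B i) \<and> card (B i) \<le> m \<and>
      range (F i) \<subseteq> complex_vector.span (B i)"
    using span by metis
  have "(\<Sum>i\<in>I. F i x) \<in> complex_vector.span (\<Union>i\<in>I. B i)" for x
  proof (rule complex_vector.span_sum)
    fix i assume i: "i \<in> I"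
    then have "complex_vector.span (B i) \<subseteq> complex_vector.span (\<Union>i\<in>I. B i)"
      by (intro complex_vector.span_mono) auto
    then show "F i x \<in> complex_vector.span (\<Union>i\<in>I. B i)"
      using B[OF i] by blast
  qed
  moreover have "card (\<Union>i\<in>I. B i) \<le> card I * m"
  proof -
    have "card (\<Union>i\<in>I. B i) \<le> (\<Sum>i\<in>I. card (B i))"
      by (rule card_UN_le[OF I])
    also have "\<dots> \<le> card I * m"
      using sum_bounded_above[of I "\<lambda>i. card (B i)" m] B by simp
    finally show ?thesis .
  qed
  ultimately show ?thesis
    using I B by (intro exI[of _ "\<Union>i\<in>I. B i"]) auto
qed

section \<open>Singular numbers\<close>

lemma singular_number_le:
  assumes T: "bounded_clinear T" and F: "bounded_clinear F" "crank F < enat n"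
  shows "singular_number T n \<le> onorm (\<lambda>x. T x - F x)"
  unfolding singular_number_def
proof (rule cInf_lower)
  show "bdd_below {onorm (\<lambda>x. T x - F x) |F. bounded_clinear F \<and> crank F < enat n}"
    using T by (intro bdd_belowI[of _ 0])
      (auto intro!: onorm_pos_le bounded_clinear_bounded_linear bounded_clinear_diff)
qed (use F in blast)

lemma singular_number_approximant:
  assumes "n \<ge> 1" and "e > 0"
  obtains F where "bounded_clinear F" "crank F < enat n"
    "onorm (\<lambda>x. T x - F x) < singular_number T n + e"
proof -
  let ?S = "{onorm (\<lambda>x. T x - F x) |F. bounded_clinear F \<and> crank F < enat n}"
  \<comment> \<open>The infimum is over a nonempty set, since the zero operator has rank less than \<open>n\<close>.\<close>
  have "crank (\<lambda>x. 0 :: 'a) < enat n"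
    using assms by (auto simp: crank_less_iff intro!: exI[of _ "{}"])
  then have "?S \<noteq> {}"
    using bounded_clinear_zero by blast
  moreover have "Inf ?S < singular_number T n + e"
    using assms by (simp add: singular_number_def)
  ultimately have "\<exists>y\<in>?S. y < singular_number T n + e"
    by (rule cInf_lessD)
  then obtain F where "bounded_clinear F" "crank F < enat n"
      "onorm (\<lambda>x. T x - F x) < singular_number T n + e"
    by auto
  then show thesis
    by (rule that)
qed

text \<open>Negation maps the competitors for \<open>T\<close> to those for \<open>- T\<close>, preserving rank and
  distance; applying the resulting inclusion also to \<open>- T\<close> gives equality.\<close>

lemma singular_number_uminus: "singular_number (\<lambda>x. - T x) n = singular_number T n"
proof -
  have mono: "{onorm (\<lambda>x. S x - F x) |F. bounded_clinear F \<and> crank F < enat n} \<subseteq>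
      {onorm (\<lambda>x. - S x - F x) |F. bounded_clinear F \<and> crank F < enat n}"
    for S :: "'a \<Rightarrow> 'a"
  proof clarify
    fix F :: "'a \<Rightarrow> 'a" assume F: "bounded_clinear F" "crank F < enat n"
    have "onorm (\<lambda>x. - S x - (- F x)) = onorm (\<lambda>x. S x - F x)"
      using onorm_neg[of "\<lambda>x. S x - F x"] by simp
    moreover have "crank (\<lambda>x. - F x) < enat n"
      using F(2) unfolding crank_less_iff
      by (meson complex_vector.span_neg image_subset_iff)
    ultimately show "\<exists>G. onorm (\<lambda>x. S x - F x) = onorm (\<lambda>x. - S x - G x) \<and>
        bounded_clinear G \<and> crank G < enat n"
      using bounded_clinear_uminus[OF F(1)] by (intro exI[of _ "\<lambda>x. - F x"]) simp
  qed
  show ?thesis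
    unfolding singular_number_def
    using mono[of T] mono[of "\<lambda>x. - T x"] by (intro arg_cong[of _ _ Inf]) auto
qed

section \<open>Sums of products\<close>

text \<open>The competitor \<open>H\<close> for the sum collects the corrections \<open>F\<^sub>i Z\<^sub>i + (C\<^sub>i - F\<^sub>i) G\<^sub>i\<close>.  What
  remains is \<open>\<Sum>i. (C\<^sub>i - F\<^sub>i) (Z\<^sub>i - G\<^sub>i)\<close>, to which submultiplicativity of the norm applies.\<close>

lemma singular_number_sum_product_le_onorm:
  assumes I: "finite I" and rank: "card I * (2 * (j - 1)) < n"
    and C: "\<And>i. i \<in> I \<Longrightarrow> bounded_clinear (C i)" and Z: "\<And>i. i \<in> I \<Longrightarrow> bounded_clinear (Z i)"
    and F: "\<And>i. i \<in> I \<Longrightarrow> bounded_clinear (F i) \<and> crank (F i) < enat j"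
    and G: "\<And>i. i \<in> I \<Longrightarrow> bounded_clinear (G i) \<and> crank (G i) < enat j"
  shows "singular_number (\<lambda>x. \<Sum>i\<in>I. C i (Z i x)) n \<le>
    (\<Sum>i\<in>I. onorm (\<lambda>x. C i x - F i x) * onorm (\<lambda>x. Z i x - G i x))"
proof -
  define R where "R i = (\<lambda>x. C i x - F i x)" for i
  define Q where "Q i = (\<lambda>x. Z i x - G i x)" for i
  define H where "H x = (\<Sum>i\<in>I. F i (Z i x) + R i (G i x))" for x
  have R: "bounded_clinear (R i)" and Q: "bounded_clinear (Q i)" if "i \<in> I" for i
    unfolding R_def Q_def using C Z F G that by (auto intro: bounded_clinear_diff)
  have lin: "bounded_linear (R i)" "bounded_linear (Q i)" if "i \<in> I" for i
    using R Q that by (auto intro: bounded_clinear_bounded_linear)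
  have "bounded_clinear H"
    unfolding H_def
    by (rule bounded_clinear_sum, rule bounded_clinear_add)
      (simp_all add: F G Z R bounded_clinear_compose[where S = "F _"]
        bounded_clinear_compose[where S = "R _"])
  moreover have "crank H < enat n"
  proof -
    have "\<exists>B. finite B \<and> card B \<le> 2 * (j - 1) \<and>
        range (\<lambda>x. F i (Z i x) + R i (G i x)) \<subseteq> complex_vector.span B" if "i \<in> I" for i
      using F G R that by (intro correction_spanning_set) auto
    then have "\<exists>B. finite B \<and> card B \<le> card I * (2 * (j - 1)) \<and>
        range (\<lambda>x. \<Sum>i\<in>I. F i (Z i x) + R i (G i x)) \<subseteq> complex_vector.span B"
      by (rule sum_spanning_set[OF I])
    then show ?thesis
      unfolding crank_less_iff H_def using rank le_less_trans by blast
  qed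
  moreover have "bounded_clinear (\<lambda>x. \<Sum>i\<in>I. C i (Z i x))"
    by (rule bounded_clinear_sum) (simp add: C Z bounded_clinear_compose[where S = "C _"])
  ultimately have "singular_number (\<lambda>x. \<Sum>i\<in>I. C i (Z i x)) n \<le>
      onorm (\<lambda>x. (\<Sum>i\<in>I. C i (Z i x)) - H x)"
    by (intro singular_number_le)
  also have "(\<lambda>x. (\<Sum>i\<in>I. C i (Z i x)) - H x) = (\<lambda>x. \<Sum>i\<in>I. R i (Q i x))"
  proof
    fix x
    have "C i (Z i x) - (F i (Z i x) + R i (G i x)) = R i (Q i x)" if "i \<in> I" for i
    proof -
      have "R i (Q i x) = R i (Z i x) - R i (G i x)"
        using linear_diff[OF bounded_linear.linear[OF lin(1)[OF that]]] by (simp add: Q_def)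
      then show ?thesis
        by (simp add: R_def)
    qed
    then show "(\<Sum>i\<in>I. C i (Z i x)) - H x = (\<Sum>i\<in>I. R i (Q i x))"
      by (simp add: H_def flip: sum_subtractf)
  qed
  also have "onorm (\<lambda>x. \<Sum>i\<in>I. R i (Q i x)) \<le> (\<Sum>i\<in>I. onorm (\<lambda>x. R i (Q i x)))"
    using I lin by (intro onorm_sum) (auto intro: bounded_linear_compose)
  also have "\<dots> \<le> (\<Sum>i\<in>I. onorm (R i) * onorm (Q i))"
    using onorm_compose[OF lin] by (intro sum_mono) (simp add: o_def)
  finally show ?thesis
    by (simp add: R_def Q_def)
qed

text \<open>Choosing the approximants within \<open>e\<close> of the infima, and then letting \<open>e\<close> tend to \<open>0\<close>,
  avoids showing that the infima are attained.\<close>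

lemma singular_number_sum_product_le:
  assumes I: "finite I" and j: "j \<ge> 1" and rank: "card I * (2 * (j - 1)) < n"
    and C: "\<And>i. i \<in> I \<Longrightarrow> bounded_clinear (C i)" and Z: "\<And>i. i \<in> I \<Longrightarrow> bounded_clinear (Z i)"
  shows "singular_number (\<lambda>x. \<Sum>i\<in>I. C i (Z i x)) n \<le>
    (\<Sum>i\<in>I. singular_number (C i) j * singular_number (Z i) j)"
proof -
  let ?s = "singular_number (\<lambda>x. \<Sum>i\<in>I. C i (Z i x)) n"
  let ?b = "\<lambda>e. \<Sum>i\<in>I. (singular_number (C i) j + e) * (singular_number (Z i) j + e)"
  have "?s \<le> ?b e" if "e > 0" for e
  proof -
    have "\<exists>F. bounded_clinear F \<and> crank F < enat j \<and>
        onorm (\<lambda>x. C i x - F x) < singular_number (C i) j + e" for i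
      by (rule singular_number_approximant[OF j \<open>e > 0\<close>, of "C i"]) blast
    then obtain F where F: "\<And>i. bounded_clinear (F i) \<and> crank (F i) < enat j \<and>
        onorm (\<lambda>x. C i x - F i x) < singular_number (C i) j + e"
      using choice[of "\<lambda>i F. bounded_clinear F \<and> crank F < enat j \<and>
        onorm (\<lambda>x. C i x - F x) < singular_number (C i) j + e"] by blast
    have "\<exists>G. bounded_clinear G \<and> crank G < enat j \<and>
        onorm (\<lambda>x. Z i x - G x) < singular_number (Z i) j + e" for i
      by (rule singular_number_approximant[OF j \<open>e > 0\<close>, of "Z i"]) blast
    then obtain G where G: "\<And>i. bounded_clinear (G i) \<and> crank (G i) < enat j \<and>
        onorm (\<lambda>x. Z i x - G i x) < singular_number (Z i) j + e"
      using choice[of "\<lambda>i G. bounded_clinear G \<and> crank G < enat j \<and>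
        onorm (\<lambda>x. Z i x - G x) < singular_number (Z i) j + e"] by blast
    have "?s \<le> (\<Sum>i\<in>I. onorm (\<lambda>x. C i x - F i x) * onorm (\<lambda>x. Z i x - G i x))"
      using F G by (intro singular_number_sum_product_le_onorm[OF I rank C Z]) auto
    also have "\<dots> \<le> ?b e"
    proof (intro sum_mono mult_mono')
      fix i assume "i \<in> I"
      then show "0 \<le> onorm (\<lambda>x. C i x - F i x)" "0 \<le> onorm (\<lambda>x. Z i x - G i x)"
        using C Z F G
        by (auto intro!: onorm_pos_le bounded_clinear_bounded_linear bounded_clinear_diff)
    qed (simp_all add: F G less_imp_le)
    finally show ?thesis .
  qed
  then have "eventually (\<lambda>e. ?s \<le> ?b e) (at_right 0)"
    by (auto simp: eventually_at_right_field intro: exI[of _ 1])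
  moreover have "(?b \<longlongrightarrow> ?b 0) (at_right 0)"
    by (intro tendsto_intros)
  ultimately have "?s \<le> ?b 0"
    by (intro tendsto_lowerbound) auto
  then show ?thesis by simp
qed

text \<open>The index of the ampliation: \<open>j = \<lceil>n / 2 k\<rceil>\<close> satisfies \<open>j - 1 < n / 2 k\<close>, which is the
  rank condition \<open>k (2 (j - 1)) < n\<close>.\<close>

lemma singular_number_sum_product_le_ampliation:
  assumes I: "finite I" "I \<noteq> {}" and n: "n \<ge> 1"
    and C: "\<And>i. i \<in> I \<Longrightarrow> bounded_clinear (C i)" and Z: "\<And>i. i \<in> I \<Longrightarrow> bounded_clinear (Z i)"
  shows "singular_number (\<lambda>x. \<Sum>i\<in>I. C i (Z i x)) n \<le>
    (\<Sum>i\<in>I. ampliation (2 * card I)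
      (\<lambda>j. singular_number (C i) j * singular_number (Z i) j) n)"
proof -
  define m where "m = 2 * card I"
  define j where "j = nat \<lceil>real n / real m\<rceil>"
  have m: "m > 0"
    using I by (simp add: m_def card_gt_0_iff)
  then have pos: "real n / real m > 0"
    using n by simp
  then have j: "j \<ge> 1"
    unfolding j_def by linarith
  have "real j - 1 < real n / real m"
    using pos unfolding j_def by linarith
  then have "real (m * (j - 1)) < real n"
    using m j by (simp add: of_nat_diff field_simps)
  then have "card I * (2 * (j - 1)) < n"
    unfolding m_def of_nat_less_iff by (simp add: mult_ac)
  then show ?thesis
    using singular_number_sum_product_le[OF I(1) j _ C Z] by (simp add: ampliation_def j_def m_def)
qed

theorem proposition6p1:
  assumes infinite_dimensional: "\<not> finite_cdim (UNIV :: 'a::complex_hilbert_space set)"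
    and separable: "separable_space (euclidean :: 'a topology)"
  shows "(\<forall>(k::nat) (T :: 'a \<Rightarrow> 'a) (C :: nat \<Rightarrow> 'a \<Rightarrow> 'a) (Z :: nat \<Rightarrow> 'a \<Rightarrow> 'a).
        k \<ge> 1 \<longrightarrow>
        (\<forall>i\<in>{1..k}. compact_operator (C i) \<and> compact_operator (Z i)) \<longrightarrow>
        T = (\<lambda>x. \<Sum>i=1..k. C i (Z i x)) \<longrightarrow>
        (\<forall>n\<ge>1. singular_number T n \<le>
          (\<Sum>i=1..k.
            ampliation (2 * k) (\<lambda>j. singular_number (C i) j * singular_number (Z i) j) n)))
    \<and> (\<forall>(T :: 'a \<Rightarrow> 'a) (C :: 'a \<Rightarrow> 'a) (Z :: 'a \<Rightarrow> 'a).
        compact_operator C \<longrightarrow> compact_operator Z \<longrightarrow>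
        T = (\<lambda>x. C (Z x) - Z (C x)) \<longrightarrow>
        (\<forall>n\<ge>1. singular_number T n \<le>
          2 * ampliation 4 (\<lambda>j. singular_number C j * singular_number Z j) n))"
proof (intro conjI allI impI)
  fix k n :: nat and T :: "'a \<Rightarrow> 'a" and C Z :: "nat \<Rightarrow> 'a \<Rightarrow> 'a"
  assume "k \<ge> 1" and cpt: "\<forall>i\<in>{1..k}. compact_operator (C i) \<and> compact_operator (Z i)"
    and T: "T = (\<lambda>x. \<Sum>i=1..k. C i (Z i x))" and "n \<ge> 1"
  then show "singular_number T n \<le> (\<Sum>i=1..k.
      ampliation (2 * k) (\<lambda>j. singular_number (C i) j * singular_number (Z i) j) n)"
    using singular_number_sum_product_le_ampliation[of "{1..k}" n C Z]
    by (simp add: compact_operator_def)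
next
  fix n :: nat and T C Z :: "'a \<Rightarrow> 'a"
  assume cpt: "compact_operator C" "compact_operator Z"
    and T: "T = (\<lambda>x. C (Z x) - Z (C x))" and n: "n \<ge> 1"
  \<comment> \<open>The two summands \<open>C Z\<close> and \<open>(- Z) C\<close> are indexed by the type \<open>bool\<close>.\<close>
  define A where "A b = (if b then C else (\<lambda>x. - Z x))" for b
  define B where "B b = (if b then Z else C)" for b
  have "bounded_clinear (A b)" "bounded_clinear (B b)" for b
    using cpt by (auto simp: A_def B_def compact_operator_def bounded_clinear_uminus)
  then have "singular_number (\<lambda>x. \<Sum>b\<in>UNIV. A b (B b x)) n \<le>
      (\<Sum>b\<in>UNIV. ampliation (2 * card (UNIV :: bool set))
        (\<lambda>j. singular_number (A b) j * singular_number (B b) j) n)"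
    by (intro singular_number_sum_product_le_ampliation n) auto
  moreover have "(\<lambda>x. \<Sum>b\<in>UNIV. A b (B b x)) = T"
    by (simp add: T A_def B_def UNIV_bool add.commute)
  ultimately show "singular_number T n \<le>
      2 * ampliation 4 (\<lambda>j. singular_number C j * singular_number Z j) n"
    by (simp add: UNIV_bool A_def B_def ampliation_def singular_number_uminus mult.commute)
qed

end
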